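(* Let $G$ be a branch group acting on an infinite, locally finite, spherically homogeneous rooted tree $T$, and let $\partial T$ be the boundary of the tree $T$, which is homeomorphic to the Cantor set. Then, for all $x,y\in\partial T$, there exists an automorphism $f\colon T\rightarrow T$ of the rooted tree $T$ such that $f\,\mathrm{St}_G^0(x)\,f^{-1}=\mathrm{St}_G^0(y)$.
   Context: A rooted tree $T$ is spherically homogeneous if any two vertices at the same distance $n$ from the root (i.e. on the same level $n$) have the same number of children; as usual in the theory of branch groups, each vertex is assumed to have at least two children, and this number is finite since $T$ is locally finite. Automorphisms of the rooted tree are graph automorphisms fixing the root. The boundary $\partial T$ is the set of infinite geodesic rays starting at the root, with the topology generated by the sets of rays passing through a given vertex; $\mathrm{Aut}(T)$ acts on it by homeomorphisms. For a subgroup $G\leq\mathrm{Aut}(T)$ and a vertex $v$, the rigid stabiliser $\mathrm{Rist}_G(v)$ is the subgroup of all $g\in G$ that fix every vertex outside of the subtree $T_v$ of descendants of $v$ (including $v$). The group $G\leq \mathrm{Aut}(T)$ is a branch group if it acts transitively on each level of $T$ and if, for every $n$, the subgroup $\prod_{|v|=n}\mathrm{Rist}_G(v)$ generated by the rigid stabilisers of the vertices of level $n$ has finite index in $G$. For $x\in\partial T$, $\mathrm{St}_G^0(x)$ is the subgroup of all $g\in G$ with $g(x)=x$ whose set of fixed points in $\partial T$ contains an open neighbourhood of $x$ in $\partial T$. *)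

theory Defs
  imports "HOL-Analysis.Abstract_Topology" "HOL-Algebra.Bij" "HOL-Algebra.Generated_Groups"
begin

section \<open>Rooted trees\<close>

record 'v rooted_graph =
  verts :: "'v set"
  adj :: "'v \<Rightarrow> 'v \<Rightarrow> bool"
  rootv :: 'v

definition simple_graph :: "'v rooted_graph \<Rightarrow> bool" where
  "simple_graph T \<longleftrightarrow>
     (\<forall>u v. adj T u v \<longrightarrow> u \<in> verts T \<and> v \<in> verts T) \<and> symp (adj T) \<and> irreflp (adj T)"

definition connected_graph :: "'v rooted_graph \<Rightarrow> bool" where
  "connected_graph T \<longleftrightarrow> (\<forall>u \<in> verts T. \<forall>v \<in> verts T. (adj T)\<^sup>*\<^sup>* u v)"

definition cycle :: "'v rooted_graph \<Rightarrow> 'v list \<Rightarrow> bool" where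
  "cycle T c \<longleftrightarrow>
     3 \<le> length c \<and> distinct c \<and> successively (adj T) c \<and> adj T (last c) (hd c)"

definition rooted_tree :: "'v rooted_graph \<Rightarrow> bool" where
  "rooted_tree T \<longleftrightarrow>
     simple_graph T \<and> rootv T \<in> verts T \<and> connected_graph T \<and> (\<nexists>c. cycle T c)"

text \<open>The graph distance is the least length of a walk; it is only meaningful for pairs of
  vertices joined by a walk, hence for all pairs of vertices of a rooted tree.\<close>

definition gdist :: "'v rooted_graph \<Rightarrow> 'v \<Rightarrow> 'v \<Rightarrow> nat" where
  "gdist T u v = (LEAST n. (adj T ^^ n) u v)"

definition level :: "'v rooted_graph \<Rightarrow> nat \<Rightarrow> 'v set" where
  "level T n = {v \<in> verts T. gdist T (rootv T) v = n}"

definition child :: "'v rooted_graph \<Rightarrow> 'v \<Rightarrow> 'v \<Rightarrow> bool" where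
  "child T v u \<longleftrightarrow> adj T v u \<and> gdist T (rootv T) u = Suc (gdist T (rootv T) v)"

definition children :: "'v rooted_graph \<Rightarrow> 'v \<Rightarrow> 'v set" where
  "children T v = {u. child T v u}"

definition subtree :: "'v rooted_graph \<Rightarrow> 'v \<Rightarrow> 'v set" where
  "subtree T v = {u. (child T)\<^sup>*\<^sup>* v u}"

definition locally_finite :: "'v rooted_graph \<Rightarrow> bool" where
  "locally_finite T \<longleftrightarrow> (\<forall>v \<in> verts T. finite {u. adj T v u})"

text \<open>Cardinalities are taken in \<^typ>\<open>nat\<close>; the sets of children are finite because the
  notion is only used together with \<^const>\<open>locally_finite\<close>. The lower bound is the
  standing convention that each vertex has at least two children.\<close>

definition spherically_homogeneous :: "'v rooted_graph \<Rightarrow> bool" where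
  "spherically_homogeneous T \<longleftrightarrow>
     (\<forall>n. \<forall>u \<in> level T n. \<forall>v \<in> level T n. card (children T u) = card (children T v)) \<and>
     (\<forall>v \<in> verts T. 2 \<le> card (children T v))"

section \<open>Automorphisms and branch groups\<close>

text \<open>As elements of \<^const>\<open>Bij\<close>, automorphisms are extensional functions, i.e. they take the
  value \<^const>\<open>undefined\<close> outside \<^term>\<open>verts T\<close>.\<close>

definition tree_aut :: "'v rooted_graph \<Rightarrow> ('v \<Rightarrow> 'v) set" where
  "tree_aut T = {f \<in> Bij (verts T).
     (\<forall>u \<in> verts T. \<forall>v \<in> verts T. adj T (f u) (f v) \<longleftrightarrow> adj T u v) \<and> f (rootv T) = rootv T}"

definition Aut :: "'v rooted_graph \<Rightarrow> ('v \<Rightarrow> 'v) monoid" where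
  "Aut T = BijGroup (verts T)\<lparr>carrier := tree_aut T\<rparr>"

definition Rist :: "'v rooted_graph \<Rightarrow> ('v \<Rightarrow> 'v) set \<Rightarrow> 'v \<Rightarrow> ('v \<Rightarrow> 'v) set" where
  "Rist T G v = {g \<in> G. \<forall>u \<in> verts T - subtree T v. g u = u}"

definition level_Rist :: "'v rooted_graph \<Rightarrow> ('v \<Rightarrow> 'v) set \<Rightarrow> nat \<Rightarrow> ('v \<Rightarrow> 'v) set" where
  "level_Rist T G n = generate (Aut T) (\<Union>v \<in> level T n. Rist T G v)"

definition branch_group :: "'v rooted_graph \<Rightarrow> ('v \<Rightarrow> 'v) set \<Rightarrow> bool" where
  "branch_group T G \<longleftrightarrow>
     subgroup G (Aut T) \<and>
     (\<forall>n. \<forall>u \<in> level T n. \<forall>v \<in> level T n. \<exists>g \<in> G. g u = v) \<and>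
     (\<forall>n. finite (rcosets\<^bsub>Aut T\<lparr>carrier := G\<rparr>\<^esub> (level_Rist T G n)))"

section \<open>The boundary\<close>

definition boundary :: "'v rooted_graph \<Rightarrow> (nat \<Rightarrow> 'v) set" where
  "boundary T = {x. x 0 = rootv T \<and> (\<forall>n. adj T (x n) (x (Suc n))) \<and>
     (\<forall>m n. m \<le> n \<longrightarrow> gdist T (x m) (x n) = n - m)}"

definition rays_through :: "'v rooted_graph \<Rightarrow> 'v \<Rightarrow> (nat \<Rightarrow> 'v) set" where
  "rays_through T v = {x \<in> boundary T. v \<in> range x}"

definition boundary_topology :: "'v rooted_graph \<Rightarrow> (nat \<Rightarrow> 'v) topology" where
  "boundary_topology T = topology_generated_by (rays_through T ` verts T)"

text \<open>An automorphism \<^term>\<open>g\<close> sends the ray \<^term>\<open>x\<close> to the ray \<^term>\<open>g \<circ> x\<close>.\<close>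

definition St0 :: "'v rooted_graph \<Rightarrow> ('v \<Rightarrow> 'v) set \<Rightarrow> (nat \<Rightarrow> 'v) \<Rightarrow> ('v \<Rightarrow> 'v) set" where
  "St0 T G x = {g \<in> G. g \<circ> x = x \<and>
     (\<exists>U. openin (boundary_topology T) U \<and> x \<in> U \<and> U \<subseteq> {y \<in> boundary T. g \<circ> y = y})}"

end

theory Submission
  imports Defs
begin

text \<open>The group \<open>St\<^sup>0(x)\<close> is the union over \<open>n\<close> of the pointwise stabilisers of the subtrees at
  the vertices \<open>x n\<close>. Since the rigid level stabilisers have finite index, the orbit closure of \<open>y\<close>
  under the rigid stabiliser of \<open>y n\<close> is a neighbourhood of \<open>y\<close>. Hence one can choose
  inductively \<open>g n \<in> G\<close> moving \<open>x\<close> closer and closer to \<open>y\<close>, in such a way that \<open>g (n + 1)\<close> arises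
  from \<open>g n\<close> by composition with an element of the rigid stabiliser of \<open>y n\<close>. The sequence is
  eventually constant at each vertex, and its limit \<open>f\<close> agrees with \<open>g n\<close> outside the subtree at
  \<open>x n\<close>; therefore \<open>f\<close> and \<open>g n\<close> conjugate the pointwise stabiliser of that subtree in the same
  way, and \<open>g n\<close> takes it to the pointwise stabiliser of the subtree at \<open>y n\<close>.\<close>

section \<open>Rooted trees\<close>

locale rtree =
  fixes T :: "'v rooted_graph"
  assumes tree: "rooted_tree T"
begin

abbreviation lvl :: "'v \<Rightarrow> nat" where "lvl v \<equiv> gdist T (rootv T) v"

lemma adj_verts: "adj T u v \<Longrightarrow> u \<in> verts T" "adj T u v \<Longrightarrow> v \<in> verts T"
  using tree unfolding rooted_tree_def simple_graph_def by blast+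

lemma adj_sym: "adj T u v \<Longrightarrow> adj T v u"
  using tree unfolding rooted_tree_def simple_graph_def by (meson sympD)

lemma root_verts: "rootv T \<in> verts T"
  using tree unfolding rooted_tree_def by blast

lemma gdist_le: "(adj T ^^ n) u v \<Longrightarrow> gdist T u v \<le> n"
  unfolding gdist_def by (rule Least_le)

lemma walk_gdist:
  assumes "u \<in> verts T" "v \<in> verts T"
  shows "(adj T ^^ gdist T u v) u v"
proof -
  have "(adj T)\<^sup>*\<^sup>* u v"
    using tree assms unfolding rooted_tree_def connected_graph_def by blast
  then obtain n where "(adj T ^^ n) u v"
    by (metis rtranclp_imp_relpowp)
  then show ?thesis unfolding gdist_def by (rule LeastI)
qed

lemma lvl_root: "lvl (rootv T) = 0"
  using gdist_le[of 0 "rootv T" "rootv T"] by simp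

lemma lvl_0: "v \<in> verts T \<Longrightarrow> lvl v = 0 \<Longrightarrow> v = rootv T"
  using walk_gdist[OF root_verts, of v] by simp

lemma lvl_adj: "adj T u v \<Longrightarrow> lvl v \<le> Suc (lvl u)"
  using gdist_le[of "Suc (lvl u)" "rootv T" v] walk_gdist[OF root_verts adj_verts(1)]
  by (auto intro: relcomppI)

lemma child_verts: "child T u v \<Longrightarrow> u \<in> verts T" "child T u v \<Longrightarrow> v \<in> verts T"
  using adj_verts unfolding child_def by blast+

lemma child_lvl: "child T u v \<Longrightarrow> lvl v = Suc (lvl u)"
  unfolding child_def by blast

text \<open>The parent is the penultimate vertex of a shortest walk from the root.\<close>

lemma parent_exists:
  assumes "v \<in> verts T" "lvl v = Suc k"
  obtains p where "child T p v" "lvl p = k"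
proof -
  have "(adj T ^^ Suc k) (rootv T) v"
    using walk_gdist[OF root_verts assms(1)] assms(2) by simp
  then obtain p where p: "(adj T ^^ k) (rootv T) p" "adj T p v" by auto
  then have "lvl p = k"
    using gdist_le[OF p(1)] lvl_adj[OF p(2)] assms(2) by simp
  with p assms(2) that show thesis unfolding child_def by simp
qed

text \<open>Climb from both vertices to parents until the parents coincide. The level bound keeps
  the new end points off the path already built, and later keeps a common child off the whole
  path.\<close>

lemma same_level_path:
  assumes "p \<in> verts T" "q \<in> verts T" "lvl p = k" "lvl q = k" "p \<noteq> q"
  shows "\<exists>c. 2 \<le> length c \<and> distinct c \<and> successively (adj T) c \<and> hd c = p \<and> last c = q
    \<and> (\<forall>v \<in> set c. lvl v \<le> k)"
  using assms
proof (induction k arbitrary: p q)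
  case 0
  then show ?case using lvl_0 by blast
next
  case (Suc k)
  obtain p' where p': "child T p' p" "lvl p' = k" using parent_exists Suc.prems by metis
  obtain q' where q': "child T q' q" "lvl q' = k" using parent_exists Suc.prems by metis
  have adj: "adj T p p'" "adj T q' q" using p' q' adj_sym unfolding child_def by blast+
  show ?case
  proof (cases "p' = q'")
    case True
    then show ?thesis
      using adj Suc.prems p' by (intro exI[of _ "[p, p', q]"]) auto
  next
    case False
    then obtain c where c: "2 \<le> length c" "distinct c" "successively (adj T) c" "hd c = p'"
      "last c = q'" "\<forall>v \<in> set c. lvl v \<le> k"
      using Suc.IH[of p' q'] p' q' child_verts by blast
    moreover have "c \<noteq> []" using c(1) by auto
    moreover have "p \<notin> set c" "q \<notin> set c" using c(6) Suc.prems by auto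
    ultimately show ?thesis
      using adj Suc.prems
      by (intro exI[of _ "p # c @ [q]"])
        (auto simp: successively_append_iff successively_Cons hd_append)
  qed
qed

text \<open>Acyclicity enters here: a path between two distinct parents that stays at or above their
  level closes up through \<open>v\<close> to a cycle.\<close>

lemma parent_unique:
  assumes "child T p v" "child T q v"
  shows "p = q"
proof (rule ccontr)
  assume "p \<noteq> q"
  moreover have "lvl q = lvl p" using child_lvl assms by (metis Suc_inject)
  ultimately obtain c where c: "2 \<le> length c" "distinct c" "successively (adj T) c" "hd c = p"
    "last c = q" "\<forall>w \<in> set c. lvl w \<le> lvl p"
    using same_level_path[OF child_verts(1)[OF assms(1)] child_verts(1)[OF assms(2)] refl] by blast
  have "c \<noteq> []" using c(1) by auto
  moreover have "v \<notin> set c" using c(6) child_lvl[OF assms(1)] by auto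
  moreover have "adj T v p" "adj T q v" using assms adj_sym unfolding child_def by blast+
  ultimately have "cycle T (v # c)"
    using c unfolding cycle_def by (simp add: successively_Cons)
  then show False using tree unfolding rooted_tree_def by blast
qed

section \<open>Descendants and uniqueness of ancestors\<close>

lemma subtree_refl: "v \<in> subtree T v"
  unfolding subtree_def by simp

lemma subtree_trans: "u \<in> subtree T v \<Longrightarrow> w \<in> subtree T u \<Longrightarrow> w \<in> subtree T v"
  unfolding subtree_def by simp

lemma subtree_verts:
  assumes "v \<in> verts T" "u \<in> subtree T v"
  shows "u \<in> verts T"
  using assms(2) unfolding subtree_def mem_Collect_eq
  by (induction rule: rtranclp_induct) (use assms(1) child_verts in blast)+

lemma subtree_lvl: "u \<in> subtree T v \<Longrightarrow> lvl v \<le> lvl u"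
  unfolding subtree_def mem_Collect_eq
  by (induction rule: rtranclp_induct) (auto dest: child_lvl)

lemma subtree_same_lvl:
  assumes "u \<in> subtree T v" "lvl u = lvl v"
  shows "u = v"
  using assms unfolding subtree_def mem_Collect_eq
proof (cases rule: rtranclp.cases)
  case (rtrancl_into_rtrancl w)
  then show ?thesis
    using assms subtree_lvl[of w v] child_lvl[of w u] unfolding subtree_def by simp
qed simp

text \<open>Descending paths ending in \<open>u\<close> can be traced back in only one way, since
  parents are unique.\<close>

lemma ancestor_unique:
  assumes "u \<in> subtree T v" "u \<in> subtree T w" "lvl v = lvl w"
  shows "v = w"
  using assms(1,2) unfolding subtree_def mem_Collect_eq
proof (induction rule: rtranclp_induct)
  case base
  then show ?case
    using subtree_same_lvl[of v w] assms(3) unfolding subtree_def by simp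
next
  case (step u' u)
  have "u' \<in> subtree T v" using step.hyps(1) unfolding subtree_def by simp
  then have "lvl w < lvl u"
    using subtree_lvl[of u' v] child_lvl[OF step.hyps(2)] assms(3) by simp
  then have "u \<noteq> w" by blast
  then obtain p where "(child T)\<^sup>*\<^sup>* w p" "child T p u"
    using step.prems by (auto elim: rtranclp.cases)
  then show ?case using step.IH parent_unique[OF step.hyps(2)] by blast
qed

section \<open>Rays\<close>

text \<open>Replaces the geodesic condition by a local one: a ray descends one level at each
  step.\<close>

lemma boundary_iff:
  "x \<in> boundary T \<longleftrightarrow> x 0 = rootv T \<and> (\<forall>n. child T (x n) (x (Suc n)))"
proof
  assume x: "x \<in> boundary T"
  then have "lvl (x n) = n" for n
    unfolding boundary_def by (metis (mono_tags, lifting) diff_zero le0 mem_Collect_eq)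
  then show "x 0 = rootv T \<and> (\<forall>n. child T (x n) (x (Suc n)))"
    using x unfolding boundary_def child_def by simp
next
  assume x: "x 0 = rootv T \<and> (\<forall>n. child T (x n) (x (Suc n)))"
  have lvl: "lvl (x n) = n" for n
  proof (induction n)
    case (Suc n)
    then show ?case using child_lvl[of "x n" "x (Suc n)"] x by simp
  qed (simp add: x lvl_root)
  have verts: "x n \<in> verts T" for n using x child_verts by blast
  have "gdist T (x m) (x n) = n - m" if "m \<le> n" for m n
  proof (rule antisym)
    have "(adj T ^^ k) (x m) (x (m + k))" for k
    proof (induction k)
      case (Suc k)
      then show ?case using x unfolding child_def by (auto intro: relcomppI)
    qed simp
    from this[of "n - m"] that show "gdist T (x m) (x n) \<le> n - m"
      using gdist_le by simp
    \<comment> \<open>Triangle inequality: a shortest walk to \<open>x m\<close> followed by one to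
      \<open>x n\<close> reaches level \<open>n\<close>, so its length is at least
      \<open>n\<close>.\<close>
    have "(adj T ^^ (m + gdist T (x m) (x n))) (rootv T) (x n)"
      using walk_gdist[OF root_verts verts[of m]] walk_gdist[OF verts verts, of m n] lvl[of m]
      by (auto simp: relpowp_add)
    then show "n - m \<le> gdist T (x m) (x n)"
      using gdist_le lvl[of n] by fastforce
  qed
  then show "x \<in> boundary T" using x unfolding boundary_def child_def by simp
qed

lemma ray_0: "x \<in> boundary T \<Longrightarrow> x 0 = rootv T"
  unfolding boundary_iff by blast

lemma ray_child: "x \<in> boundary T \<Longrightarrow> child T (x n) (x (Suc n))"
  unfolding boundary_iff by blast

lemma ray_verts: "x \<in> boundary T \<Longrightarrow> x n \<in> verts T"
  using ray_child child_verts by blast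

lemma ray_lvl: "x \<in> boundary T \<Longrightarrow> lvl (x n) = n"
  by (induction n) (simp_all add: ray_0 lvl_root child_lvl[OF ray_child])

lemma ray_subtree:
  assumes "x \<in> boundary T" "m \<le> n"
  shows "x n \<in> subtree T (x m)"
  using assms(2)
proof (induction n rule: dec_induct)
  case (step n)
  then show ?case
    using ray_child[OF assms(1), of n] unfolding subtree_def by simp
qed (rule subtree_refl)

lemma ray_through_lvl: "x \<in> boundary T \<Longrightarrow> v \<in> range x \<Longrightarrow> x (lvl v) = v"
  using ray_lvl by auto

lemma ray_ancestor:
  assumes "x \<in> boundary T" "x n \<in> subtree T v" "lvl v \<le> n"
  shows "x (lvl v) = v"
  using ancestor_unique[OF ray_subtree[OF assms(1,3)] assms(2)] ray_lvl assms(1) by simp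

lemma rays_eq_above:
  assumes "x \<in> boundary T" "z \<in> boundary T" "x n = z n" "m \<le> n"
  shows "x m = z m"
  using ray_ancestor[of x n "z m"] ray_subtree[OF assms(2,4)] ray_lvl assms by simp

lemma subtree_ray_antimono:
  "x \<in> boundary T \<Longrightarrow> m \<le> n \<Longrightarrow> subtree T (x n) \<subseteq> subtree T (x m)"
  using ray_subtree subtree_trans by blast

lemma path_from_root:
  assumes "v \<in> verts T"
  shows "\<exists>p. p 0 = rootv T \<and> p (lvl v) = v \<and> (\<forall>i < lvl v. child T (p i) (p (Suc i)))"
proof -
  have "\<exists>p. p 0 = rootv T \<and> p k = v \<and> (\<forall>i < k. child T (p i) (p (Suc i)))"
    if "v \<in> verts T" "lvl v = k" for k v
    using that
  proof (induction k arbitrary: v)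
    case 0
    then show ?case using lvl_0 by (intro exI[of _ "\<lambda>_. v"]) simp
  next
    case (Suc k)
    obtain u where u: "child T u v" "lvl u = k" using parent_exists Suc.prems by metis
    then obtain p where "p 0 = rootv T" "p k = u" "\<forall>i < k. child T (p i) (p (Suc i))"
      using Suc.IH[of u] child_verts by blast
    then show ?case
      using u by (intro exI[of _ "p(Suc k := v)"]) (auto simp: less_Suc_eq)
  qed
  then show ?thesis using assms by blast
qed

text \<open>Without leaves, the path from the root to \<open>v\<close> can be prolonged forever.
  This allows statements about rays to be turned into statements about vertices.\<close>

lemma ray_exists:
  assumes "v \<in> verts T" and children: "\<And>u. u \<in> verts T \<Longrightarrow> children T u \<noteq> {}"
  obtains z where "z \<in> boundary T" "z (lvl v) = v"
proof -
  obtain p where p: "p 0 = rootv T" "p (lvl v) = v" "\<forall>i < lvl v. child T (p i) (p (Suc i))"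
    using path_from_root[OF assms(1)] by blast
  \<comment> \<open>The clause for \<open>n = 0\<close> is part of the invariant in order to force
    the chosen sequence to start at \<open>v\<close>.\<close>
  have "\<exists>q. \<forall>n. (q n \<in> verts T \<and> (n = 0 \<longrightarrow> q n = v)) \<and> child T (q n) (q (Suc n))"
  proof (rule dependent_nat_choice)
    fix u n
    assume "u \<in> verts T \<and> ((n::nat) = 0 \<longrightarrow> u = v)"
    then show "\<exists>w. (w \<in> verts T \<and> (Suc n = 0 \<longrightarrow> w = v)) \<and> child T u w"
      using children[of u] child_verts unfolding children_def by blast
  qed (use assms(1) in auto)
  then obtain q where q: "q 0 = v" "\<And>n. child T (q n) (q (Suc n))" by blast
  have pv: "child T (p n) v" if "Suc n = lvl v" for n using p(2,3) that by (metis lessI)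
  define z where "z n = (if n < lvl v then p n else q (n - lvl v))" for n
  have "child T (z n) (z (Suc n))" for n
  proof (cases "n < lvl v")
    case True
    then show ?thesis
      using p(3) q(1) pv[of n] unfolding z_def by (cases "Suc n = lvl v") auto
  next
    case False
    then show ?thesis using q(2)[of "n - lvl v"] unfolding z_def by (simp add: Suc_diff_le)
  qed
  moreover have "z 0 = rootv T" "z (lvl v) = v"
    using p(1,2) q(1) unfolding z_def by auto
  ultimately show thesis using that boundary_iff by blast
qed

section \<open>The automorphism group\<close>

lemma tree_aut_Bij: "f \<in> tree_aut T \<Longrightarrow> f \<in> Bij (verts T)"
  unfolding tree_aut_def by blast

lemma tree_aut_bij: "f \<in> tree_aut T \<Longrightarrow> bij_betw f (verts T) (verts T)"
  unfolding tree_aut_def Bij_def by blast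

lemma tree_aut_verts: "f \<in> tree_aut T \<Longrightarrow> v \<in> verts T \<Longrightarrow> f v \<in> verts T"
  using tree_aut_bij bij_betwE by blast

lemma tree_aut_inj:
  "f \<in> tree_aut T \<Longrightarrow> u \<in> verts T \<Longrightarrow> v \<in> verts T \<Longrightarrow> f u = f v \<Longrightarrow> u = v"
  using tree_aut_bij by (metis bij_betw_def inj_onD)

lemma tree_aut_adj:
  "f \<in> tree_aut T \<Longrightarrow> u \<in> verts T \<Longrightarrow> v \<in> verts T \<Longrightarrow> adj T (f u) (f v) \<longleftrightarrow> adj T u v"
  unfolding tree_aut_def by blast

lemma tree_aut_root: "f \<in> tree_aut T \<Longrightarrow> f (rootv T) = rootv T"
  unfolding tree_aut_def by blast

lemma tree_aut_eqI:
  assumes "f \<in> tree_aut T" "g \<in> tree_aut T" "\<And>v. v \<in> verts T \<Longrightarrow> f v = g v"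
  shows "f = g"
  using assms unfolding tree_aut_def Bij_def by (blast intro: extensionalityI)

lemma subgroup_tree_aut: "subgroup (tree_aut T) (BijGroup (verts T))"
proof (rule group.subgroupI[OF group_BijGroup])
  show "tree_aut T \<subseteq> carrier (BijGroup (verts T))"
    using tree_aut_Bij unfolding BijGroup_def by auto
  have "(\<lambda>v\<in>verts T. v) \<in> tree_aut T"
    using id_Bij root_verts unfolding tree_aut_def by auto
  then show "tree_aut T \<noteq> {}" by blast
  fix f
  assume f: "f \<in> tree_aut T"
  note bij = tree_aut_bij[OF f]
  let ?i = "\<lambda>v\<in>verts T. inv_into (verts T) f v"
  have i: "inv_into (verts T) f v \<in> verts T" "f (inv_into (verts T) f v) = v"
    if "v \<in> verts T" for v
    using that bij by (metis bij_betw_imp_surj_on inv_into_into, metis bij_betw_inv_into_right)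
  have "adj T (?i u) (?i v) \<longleftrightarrow> adj T u v" if "u \<in> verts T" "v \<in> verts T" for u v
    using tree_aut_adj[OF f i(1)[OF that(1)] i(1)[OF that(2)]] i that by simp
  moreover have "?i (rootv T) = rootv T"
    using tree_aut_inj[OF f i(1)[OF root_verts] root_verts] i(2)[OF root_verts]
      tree_aut_root[OF f] root_verts by simp
  ultimately have "?i \<in> tree_aut T"
    using restrict_inv_into_Bij[OF tree_aut_Bij[OF f]] unfolding tree_aut_def by blast
  then show "inv\<^bsub>BijGroup (verts T)\<^esub> f \<in> tree_aut T"
    using inv_BijGroup[OF tree_aut_Bij[OF f]] by simp
next
  fix f g
  assume fg: "f \<in> tree_aut T" "g \<in> tree_aut T"
  have "compose (verts T) f g \<in> Bij (verts T)"
    using compose_Bij tree_aut_Bij fg by blast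
  moreover have "adj T (compose (verts T) f g u) (compose (verts T) f g v) \<longleftrightarrow> adj T u v"
    if "u \<in> verts T" "v \<in> verts T" for u v
    using that by (simp add: compose_eq tree_aut_adj tree_aut_verts fg)
  moreover have "compose (verts T) f g (rootv T) = rootv T"
    by (simp add: compose_eq tree_aut_root root_verts fg)
  ultimately have "compose (verts T) f g \<in> tree_aut T"
    unfolding tree_aut_def by blast
  then show "f \<otimes>\<^bsub>BijGroup (verts T)\<^esub> g \<in> tree_aut T"
    using tree_aut_Bij fg unfolding BijGroup_def by simp
qed

text \<open>The rewrite turns carrier conditions in the group laws into membership in
  \<open>tree_aut T\<close>.\<close>

sublocale Aut: group "Aut T"
  rewrites carrier_Aut: "carrier (Aut T) = tree_aut T"
  unfolding Aut_def by (rule subgroup.subgroup_is_group[OF subgroup_tree_aut group_BijGroup]) simp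

section \<open>Action of automorphisms on vertices, levels, subtrees and rays\<close>

lemma Aut_mult_apply:
  "f \<in> tree_aut T \<Longrightarrow> g \<in> tree_aut T \<Longrightarrow> v \<in> verts T \<Longrightarrow> (f \<otimes>\<^bsub>Aut T\<^esub> g) v = f (g v)"
  using tree_aut_Bij unfolding Aut_def BijGroup_def by (simp add: compose_eq)

lemma Aut_one_apply: "v \<in> verts T \<Longrightarrow> \<one>\<^bsub>Aut T\<^esub> v = v"
  unfolding Aut_def BijGroup_def by simp

lemma Aut_inv_apply:
  assumes "f \<in> tree_aut T" "v \<in> verts T"
  shows "(inv\<^bsub>Aut T\<^esub> f) (f v) = v" "f ((inv\<^bsub>Aut T\<^esub> f) v) = v"
  using Aut_mult_apply[of "inv\<^bsub>Aut T\<^esub> f" f v] Aut_mult_apply[of f "inv\<^bsub>Aut T\<^esub> f" v]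
    Aut_one_apply assms by simp_all

text \<open>Walks from the root are mapped to walks from the root, so no automorphism increases a
  level; the inverse gives the other inequality.\<close>

lemma tree_aut_lvl:
  assumes "f \<in> tree_aut T" "v \<in> verts T"
  shows "lvl (f v) = lvl v"
proof -
  have walk: "(adj T ^^ n) (rootv T) (g u)"
    if "g \<in> tree_aut T" "(adj T ^^ n) (rootv T) u" for g u n
    using that(2)
  proof (induction n arbitrary: u)
    case 0
    then show ?case using tree_aut_root[OF that(1)] by simp
  next
    case (Suc n)
    then obtain w where "(adj T ^^ n) (rootv T) w" "adj T w u" by auto
    then show ?case
      using Suc.IH[of w] tree_aut_adj[OF that(1), of w u] adj_verts[of w u]
      by (simp add: relcomppI[of _ _ "g w"])
  qed
  have le: "lvl (g u) \<le> lvl u" if "g \<in> tree_aut T" "u \<in> verts T" for g u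
    using gdist_le walk[OF that(1)] walk_gdist[OF root_verts that(2)] by blast
  have "inv\<^bsub>Aut T\<^esub> f \<in> tree_aut T" using assms(1) by simp
  from le[OF this tree_aut_verts[OF assms]] le[OF assms] Aut_inv_apply(1)[OF assms]
  show ?thesis by simp
qed

lemma tree_aut_child: "f \<in> tree_aut T \<Longrightarrow> child T u v \<Longrightarrow> child T (f u) (f v)"
  using tree_aut_adj tree_aut_lvl child_verts unfolding child_def by metis

lemma tree_aut_subtree:
  assumes "f \<in> tree_aut T" "u \<in> subtree T v"
  shows "f u \<in> subtree T (f v)"
  using assms(2) unfolding subtree_def mem_Collect_eq
  by (induction rule: rtranclp_induct) (auto intro: tree_aut_child[OF assms(1)] rtranclp.intros)

lemma tree_aut_subtree_iff:
  assumes "f \<in> tree_aut T" "v \<in> verts T" "u \<in> verts T"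
  shows "f u \<in> subtree T (f v) \<longleftrightarrow> u \<in> subtree T v"
  using tree_aut_subtree[of "inv\<^bsub>Aut T\<^esub> f" "f u" "f v"] tree_aut_subtree assms
    Aut_inv_apply(1) by auto

lemma tree_aut_ray: "f \<in> tree_aut T \<Longrightarrow> x \<in> boundary T \<Longrightarrow> f \<circ> x \<in> boundary T"
  unfolding boundary_iff by (simp add: tree_aut_root tree_aut_child)

section \<open>Neighbourhood stabilisers\<close>

text \<open>The sets of rays through the vertices of \<open>x\<close> form a neighbourhood base at
  \<open>x\<close>: they are nested, so the deeper of two serves for an intersection.\<close>

lemma open_contains_rays_through:
  assumes "openin (boundary_topology T) U" "x \<in> U" "x \<in> boundary T"
  shows "\<exists>n. rays_through T (x n) \<subseteq> U"
proof -
  have "generate_topology_on (rays_through T ` verts T) U"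
    using assms(1) unfolding boundary_topology_def openin_topology_generated_by_iff .
  then show ?thesis using assms(2)
  proof (induction rule: generate_topology_on.induct)
    case (Int a b)
    then obtain m n where mn: "rays_through T (x m) \<subseteq> a" "rays_through T (x n) \<subseteq> b" by blast
    have mono: "rays_through T (x (max m n)) \<subseteq> rays_through T (x k)" if "k \<le> max m n" for k
    proof
      fix z
      assume z: "z \<in> rays_through T (x (max m n))"
      then have "z (max m n) = x (max m n)"
        using ray_through_lvl[of z "x (max m n)"] ray_lvl[OF assms(3)]
        unfolding rays_through_def by auto
      then have "x k = z k"
        using rays_eq_above assms(3) z that unfolding rays_through_def by (metis mem_Collect_eq)
      with z show "z \<in> rays_through T (x k)"
        unfolding rays_through_def by simp
    qed
    show ?case using mn mono[of m] mono[of n] by (intro exI[of _ "max m n"]) auto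
  next
    case (UN K)
    then show ?case by (meson UnionE Union_upper order_trans)
  next
    case (Basis s)
    then show ?case unfolding rays_through_def by auto
  qed simp
qed

text \<open>Removes the topology. Every vertex below \<open>x n\<close> lies on a ray through
  \<open>x n\<close>, so fixing these rays fixes the subtree. Conversely, a ray through
  \<open>x n\<close> is fixed from level \<open>n\<close> on, hence also above, since a vertex
  determines its ancestors.\<close>

lemma St0_iff:
  assumes x: "x \<in> boundary T" and G: "G \<subseteq> tree_aut T"
    and children: "\<And>u. u \<in> verts T \<Longrightarrow> children T u \<noteq> {}"
  shows "g \<in> St0 T G x \<longleftrightarrow> g \<in> G \<and> (\<exists>n. \<forall>v \<in> subtree T (x n). g v = v)"
proof
  assume "g \<in> St0 T G x"
  then obtain U where g: "g \<in> G" and U: "openin (boundary_topology T) U" "x \<in> U"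
    "U \<subseteq> {y \<in> boundary T. g \<circ> y = y}"
    unfolding St0_def by blast
  obtain n where n: "rays_through T (x n) \<subseteq> U"
    using open_contains_rays_through[OF U(1,2) x] by blast
  have "g v = v" if v: "v \<in> subtree T (x n)" for v
  proof -
    have verts: "v \<in> verts T" using subtree_verts[OF ray_verts[OF x] v] .
    obtain z where z: "z \<in> boundary T" "z (lvl v) = v"
      using ray_exists[OF verts children] by blast
    have "z n = x n"
      using ray_ancestor[OF z(1), of "lvl v" "x n"] v z(2) subtree_lvl[OF v] ray_lvl[OF x]
      by simp
    then have "z \<in> rays_through T (x n)"
      using z(1) rangeI[of z n] unfolding rays_through_def by simp
    then have "g \<circ> z = z" using n U(3) by blast
    then show ?thesis using z(2) by (metis comp_apply)
  qed
  with g show "g \<in> G \<and> (\<exists>n. \<forall>v \<in> subtree T (x n). g v = v)" by blast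
next
  assume "g \<in> G \<and> (\<exists>n. \<forall>v \<in> subtree T (x n). g v = v)"
  then obtain n where g: "g \<in> G" and n: "\<And>v. v \<in> subtree T (x n) \<Longrightarrow> g v = v" by blast
  have fixed: "g \<circ> z = z" if "z \<in> rays_through T (x n)" for z
  proof
    fix k
    have z: "z \<in> boundary T" "z n = x n"
      using that ray_through_lvl[of z "x n"] ray_lvl[OF x] unfolding rays_through_def by auto
    have ge: "g (z m) = z m" if "n \<le> m" for m
      using n ray_subtree[OF z(1) that] z(2) by simp
    show "(g \<circ> z) k = z k"
    proof (cases "n \<le> k")
      case False
      then show ?thesis
        using rays_eq_above[of "g \<circ> z" z n k] tree_aut_ray[of g z] ge[of n] g G z(1) by auto
    qed (simp add: ge)
  qed
  have "openin (boundary_topology T) (rays_through T (x n))"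
    unfolding boundary_topology_def
    using ray_verts[OF x] by (intro topology_generated_by_Basis) blast
  moreover have "x \<in> rays_through T (x n)" using x unfolding rays_through_def by blast
  moreover have "rays_through T (x n) \<subseteq> {y \<in> boundary T. g \<circ> y = y}"
    using fixed unfolding rays_through_def by blast
  ultimately show "g \<in> St0 T G x"
    using g fixed unfolding St0_def by blast
qed

section \<open>Rigid stabilisers\<close>

text \<open>If \<open>g u\<close> lay outside, it would be fixed, and injectivity would give
  \<open>g u = u\<close>.\<close>

lemma tree_aut_fix_outside_subtree:
  assumes "g \<in> tree_aut T" "v \<in> verts T" "\<And>u. u \<in> verts T - subtree T v \<Longrightarrow> g u = u"
    "u \<in> subtree T v"
  shows "g u \<in> subtree T v"
proof (rule ccontr)
  assume "g u \<notin> subtree T v"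
  moreover have u: "u \<in> verts T" using subtree_verts assms(2,4) .
  ultimately have "g (g u) = g u" using assms(3) tree_aut_verts[OF assms(1)] by blast
  then have "g u = u" using tree_aut_inj assms(1) u tree_aut_verts by metis
  with \<open>g u \<notin> subtree T v\<close> assms(4) show False by simp
qed

lemma Rist_subtree:
  assumes "G \<subseteq> tree_aut T" "v \<in> verts T" "g \<in> Rist T G v" "u \<in> subtree T v"
  shows "g u \<in> subtree T v"
  using tree_aut_fix_outside_subtree[of g v u] assms unfolding Rist_def by blast

lemma subgroup_Rist:
  assumes G: "subgroup G (Aut T)"
  shows "subgroup (Rist T G v) (Aut T)"
proof (rule Aut.subgroupI)
  have sub: "G \<subseteq> tree_aut T" using subgroup.subset[OF G] carrier_Aut by simp
  then show "Rist T G v \<subseteq> tree_aut T" unfolding Rist_def by blast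
  have "\<one>\<^bsub>Aut T\<^esub> \<in> Rist T G v"
    using subgroup.one_closed[OF G] Aut_one_apply unfolding Rist_def by blast
  then show "Rist T G v \<noteq> {}" by blast
  fix a
  assume a: "a \<in> Rist T G v"
  have "(inv\<^bsub>Aut T\<^esub> a) u = u" if "u \<in> verts T - subtree T v" for u
    using Aut_inv_apply(1)[of a u] a that sub unfolding Rist_def by auto
  then show "inv\<^bsub>Aut T\<^esub> a \<in> Rist T G v"
    using a subgroup.m_inv_closed[OF G] unfolding Rist_def by blast
  fix b
  assume b: "b \<in> Rist T G v"
  have "(a \<otimes>\<^bsub>Aut T\<^esub> b) u = u" if "u \<in> verts T - subtree T v" for u
    using Aut_mult_apply[of a b u] a b that sub unfolding Rist_def by auto
  then show "a \<otimes>\<^bsub>Aut T\<^esub> b \<in> Rist T G v"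
    using a b subgroup.m_closed[OF G] unfolding Rist_def by blast
qed

lemma level_verts: "v \<in> level T n \<Longrightarrow> v \<in> verts T" "v \<in> level T n \<Longrightarrow> lvl v = n"
  unfolding level_def by blast+

lemma level_Rist_subset:
  assumes "subgroup G (Aut T)"
  shows "level_Rist T G n \<subseteq> G"
  unfolding level_Rist_def
  by (rule Aut.generate_subgroup_incl[OF _ assms]) (auto simp: Rist_def)

text \<open>Only the factors from \<open>Rist T G v\<close> act on the subtree at \<open>v\<close>;
  those from the other vertices of the level are trivial there.\<close>

lemma level_Rist_restrict:
  assumes G: "subgroup G (Aut T)" and v: "v \<in> level T n" and r: "r \<in> level_Rist T G n"
  shows "\<exists>r' \<in> Rist T G v. \<forall>u \<in> subtree T v. r u = r' u"
proof -
  have sub: "G \<subseteq> tree_aut T" using subgroup.subset[OF G] carrier_Aut by simp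
  have single: "\<exists>r' \<in> Rist T G v. \<forall>u \<in> subtree T v. h u = r' u"
    if w: "w \<in> level T n" and h: "h \<in> Rist T G w" for h w
  proof (cases "w = v")
    case False
    have "h u = \<one>\<^bsub>Aut T\<^esub> u" if u: "u \<in> subtree T v" for u
    proof -
      have "u \<in> verts T" using subtree_verts[OF level_verts(1)[OF v] u] .
      moreover have "u \<notin> subtree T w"
        using ancestor_unique[OF u, of w] level_verts(2)[OF v] level_verts(2)[OF w] False by auto
      ultimately show ?thesis using h Aut_one_apply unfolding Rist_def by auto
    qed
    then show ?thesis using subgroup.one_closed[OF subgroup_Rist[OF G]] by blast
  qed (use h in blast)
  show ?thesis
    using r unfolding level_Rist_def
  proof (induction rule: generate.induct)
    case one
    show ?case using subgroup.one_closed[OF subgroup_Rist[OF G]] by blast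
  next
    case (incl h)
    then show ?case using single by blast
  next
    case (inv h)
    then show ?case using single subgroup.m_inv_closed[OF subgroup_Rist[OF G]] by blast
  next
    case (eng h1 h2)
    obtain r1 where r1: "r1 \<in> Rist T G v" "\<forall>u \<in> subtree T v. h1 u = r1 u"
      using eng.IH(1) by blast
    obtain r2 where r2: "r2 \<in> Rist T G v" "\<forall>u \<in> subtree T v. h2 u = r2 u"
      using eng.IH(2) by blast
    have aut: "h1 \<in> tree_aut T" "h2 \<in> tree_aut T" "r1 \<in> tree_aut T" "r2 \<in> tree_aut T"
      using eng.hyps level_Rist_subset[OF G, of n] r1(1) r2(1) sub
      unfolding level_Rist_def Rist_def by blast+
    \<comment> \<open>\<open>r2\<close> preserves the subtree, so \<open>h1\<close> may be replaced
      by \<open>r1\<close> at the point \<open>r2 u\<close>.\<close>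
    have "(h1 \<otimes>\<^bsub>Aut T\<^esub> h2) u = (r1 \<otimes>\<^bsub>Aut T\<^esub> r2) u" if u: "u \<in> subtree T v" for u
    proof -
      have "u \<in> verts T" using subtree_verts[OF level_verts(1)[OF v] u] .
      moreover have "r2 u \<in> subtree T v"
        using Rist_subtree[OF sub level_verts(1)[OF v] r2(1) u] .
      ultimately show ?thesis using u r1(2) r2(2) by (simp add: Aut_mult_apply aut)
    qed
    then show ?case using subgroup.m_closed[OF subgroup_Rist[OF G] r1(1) r2(1)] by blast
  qed
qed

text \<open>Call a coset \<open>C\<close> of the rigid level stabiliser bad if, at some level, no element of \<open>C\<close> fixes the
  vertex of \<open>y\<close>. There are finitely many cosets, so all bad cosets are detected at one level \<open>N\<close>;
  an element of \<open>G\<close> fixing \<open>y N\<close> lies in a good coset.\<close>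

lemma Rist_orbit_neighbourhood:
  assumes branch: "branch_group T G" and y: "y \<in> boundary T"
  shows "\<exists>N\<ge>n. \<forall>m\<ge>N. \<forall>u \<in> level T m \<inter> subtree T (y N). \<exists>r \<in> Rist T G (y n). r u = y m"
proof -
  define R where "R = level_Rist T G n"
  define cosets where "cosets = rcosets\<^bsub>Aut T\<lparr>carrier := G\<rparr>\<^esub> R"
  have G: "subgroup G (Aut T)" and fin: "finite cosets"
    and trans: "\<And>n u v. u \<in> level T n \<Longrightarrow> v \<in> level T n \<Longrightarrow> \<exists>g \<in> G. g u = v"
    using branch unfolding branch_group_def cosets_def R_def by blast+
  have sub: "G \<subseteq> tree_aut T" using subgroup.subset[OF G] carrier_Aut by simp
  have RG: "R \<subseteq> G" unfolding R_def by (rule level_Rist_subset[OF G])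
  have level: "y k \<in> level T k" for k
    using ray_verts[OF y] ray_lvl[OF y] unfolding level_def by simp
  define bad where "bad C m \<longleftrightarrow> (\<forall>c \<in> C. c (y m) \<noteq> y m)" for C m
  \<comment> \<open>For a coset that is bad at no level this is an unspecified number; that is
    harmless, as \<open>N\<close> only has to be large enough.\<close>
  define M where "M C = (LEAST m. bad C m)" for C
  define N where "N = Max (insert n (M ` cosets))"
  have "n \<le> N" and MN: "\<And>C. C \<in> cosets \<Longrightarrow> M C \<le> N"
    using fin unfolding N_def by auto
  have "\<exists>r \<in> Rist T G (y n). r u = y m"
    if m: "N \<le> m" and u: "u \<in> level T m" "u \<in> subtree T (y N)" for m u
  proof -
    obtain g where g: "g \<in> G" "g (y m) = u" using trans[OF level u(1)] by blast
    have aut: "g \<in> tree_aut T" using g(1) sub by blast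
    have ray: "g \<circ> y \<in> boundary T" using tree_aut_ray[OF aut y] .
    have "(g \<circ> y) N = y N"
      using ray_ancestor[OF ray, of m "y N"] u(2) g(2) m ray_lvl[OF y] by simp
    then have fixed: "g (y k) = y k" if "k \<le> N" for k
      using rays_eq_above[OF ray y _ that] by simp
    define C where "C = R #>\<^bsub>Aut T\<^esub> g"
    have C: "C \<in> cosets"
      using g(1) unfolding C_def cosets_def RCOSETS_def r_coset_def by auto
    have "\<one>\<^bsub>Aut T\<^esub> \<in> R" unfolding R_def level_Rist_def by (rule generate.one)
    moreover have "\<one>\<^bsub>Aut T\<^esub> \<otimes>\<^bsub>Aut T\<^esub> g = g" using aut by simp
    ultimately have "g \<in> C" unfolding C_def r_coset_def by force
    \<comment> \<open>As \<open>M C\<close> is at most \<open>N\<close>, the element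
      \<open>g\<close> of \<open>C\<close> fixes the vertex of \<open>y\<close> at level
      \<open>M C\<close>. Were \<open>C\<close> bad anywhere, it would be bad at \<open>M C\<close>;
      so some \<open>r \<otimes> g\<close> in \<open>C\<close> fixes \<open>y m\<close>, and
      \<open>r\<close> moves \<open>u\<close> to \<open>y m\<close>.\<close>
    then have "\<not> bad C (M C)"
      using fixed[OF MN[OF C]] unfolding bad_def by blast
    then have "\<not> bad C m" unfolding M_def by (metis LeastI)
    then obtain r where r: "r \<in> R" "(r \<otimes>\<^bsub>Aut T\<^esub> g) (y m) = y m"
      unfolding bad_def C_def r_coset_def by blast
    have "r \<in> tree_aut T" using r(1) RG sub by blast
    then have "r u = y m"
      using r(2) Aut_mult_apply[OF _ aut ray_verts[OF y]] g(2) by simp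
    moreover have "u \<in> subtree T (y n)"
      using subtree_ray_antimono[OF y \<open>n \<le> N\<close>] u(2) by blast
    ultimately show ?thesis
      using level_Rist_restrict[OF G level] r(1) unfolding R_def by metis
  qed
  with \<open>n \<le> N\<close> show ?thesis by blast
qed

section \<open>The conjugating automorphism\<close>

text \<open>The induction carries a stronger invariant: \<open>g n\<close> matches \<open>x\<close>
  and \<open>y\<close> down to the depth \<open>N n\<close> at which the orbit of the rigid
  stabiliser of \<open>y n\<close> fills a neighbourhood of \<open>y\<close>. This leaves room for
  the next correction.\<close>

lemma approximating_sequence:
  assumes branch: "branch_group T G" and x: "x \<in> boundary T" and y: "y \<in> boundary T"
  obtains g where "\<And>n. g n \<in> G" "\<And>n. g n (x n) = y n"
    "\<And>n v. v \<in> verts T - subtree T (x n) \<Longrightarrow> g (Suc n) v = g n v"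
proof -
  have G: "subgroup G (Aut T)"
    and trans: "\<And>n u v. u \<in> level T n \<Longrightarrow> v \<in> level T n \<Longrightarrow> \<exists>g \<in> G. g u = v"
    using branch unfolding branch_group_def by blast+
  have sub: "G \<subseteq> tree_aut T" using subgroup.subset[OF G] carrier_Aut by simp
  obtain N where N: "\<And>n. n \<le> N n"
    "\<And>n m u. N n \<le> m \<Longrightarrow> u \<in> level T m \<Longrightarrow> u \<in> subtree T (y (N n)) \<Longrightarrow>
      \<exists>r \<in> Rist T G (y n). r u = y m"
    using Rist_orbit_neighbourhood[OF branch y] by (metis IntI)
  have up: "g (x k) = y k" if "g \<in> G" "g (x m) = y m" "k \<le> m" for g k m
    using rays_eq_above[OF tree_aut_ray[of g, OF _ x] y _ that(3)] that sub by auto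
  have level: "z k \<in> level T k" if "z \<in> boundary T" for z k
    using ray_verts[OF that] ray_lvl[OF that] unfolding level_def by simp
  have "\<exists>g. \<forall>n. (g n \<in> G \<and> g n (x (N n)) = y (N n)) \<and>
    (\<forall>v \<in> verts T - subtree T (x n). g (Suc n) v = g n v)"
  proof (rule dependent_nat_choice)
    show "\<exists>g. g \<in> G \<and> g (x (N 0)) = y (N 0)" using trans[OF level[OF x] level[OF y]] by blast
    fix g n
    assume g: "g \<in> G \<and> g (x (N n)) = y (N n)"
    then have aut: "g \<in> tree_aut T" using sub by blast
    \<comment> \<open>Depth at least \<open>N n\<close> puts \<open>g (x m)\<close> within reach of
      \<open>Rist T G (y n)\<close>; depth at least \<open>N (Suc n)\<close> gives the next
      invariant.\<close>
    define m where "m = max (N n) (N (Suc n))"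
    have "g (x m) \<in> level T m"
      using tree_aut_verts[OF aut] tree_aut_lvl[OF aut] ray_verts[OF x] ray_lvl[OF x]
      unfolding level_def by simp
    moreover have "g (x m) \<in> subtree T (y (N n))"
      using tree_aut_subtree[OF aut ray_subtree[OF x, of "N n" m]] g unfolding m_def by simp
    ultimately obtain r where r: "r \<in> Rist T G (y n)" "r (g (x m)) = y m"
      using N(2)[of n m] unfolding m_def by auto
    have rG: "r \<in> G" and raut: "r \<in> tree_aut T" using r(1) sub unfolding Rist_def by blast+
    have prod: "r \<otimes>\<^bsub>Aut T\<^esub> g \<in> G" using subgroup.m_closed[OF G rG] g by blast
    have "(r \<otimes>\<^bsub>Aut T\<^esub> g) (x m) = y m"
      using r(2) by (simp add: Aut_mult_apply raut aut ray_verts[OF x])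
    then have "(r \<otimes>\<^bsub>Aut T\<^esub> g) (x (N (Suc n))) = y (N (Suc n))"
      using up[OF prod] unfolding m_def by simp
    \<comment> \<open>Since \<open>g\<close> sends \<open>x n\<close> to \<open>y n\<close>, it maps
      vertices outside the subtree at \<open>x n\<close> to vertices outside the one at
      \<open>y n\<close>, where \<open>r\<close> is trivial.\<close>
    moreover have "(r \<otimes>\<^bsub>Aut T\<^esub> g) v = g v" if v: "v \<in> verts T - subtree T (x n)" for v
    proof -
      have "g (x n) = y n" using up g N(1) by blast
      then have "g v \<notin> subtree T (y n)"
        using tree_aut_subtree_iff[OF aut ray_verts[OF x], of v n] v by auto
      then show ?thesis
        using v r(1) tree_aut_verts[OF aut] unfolding Rist_def
        by (simp add: Aut_mult_apply raut aut)
    qed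
    ultimately show "\<exists>h. (h \<in> G \<and> h (x (N (Suc n))) = y (N (Suc n))) \<and>
        (\<forall>v \<in> verts T - subtree T (x n). h v = g v)"
      using prod by blast
  qed
  then obtain g where g: "\<And>n. g n \<in> G" "\<And>n. g n (x (N n)) = y (N n)"
    "\<And>n v. v \<in> verts T - subtree T (x n) \<Longrightarrow> g (Suc n) v = g n v"
    by blast
  show thesis by (rule that[of g]) (use g up N(1) in blast)+
qed

text \<open>A vertex lies outside the subtree at \<open>x n\<close> as soon as \<open>n\<close>
  exceeds its level, so the values there stabilise. Any two vertices share an index at which the
  limit agrees with an automorphism.\<close>

lemma limit_automorphism:
  assumes x: "x \<in> boundary T" and g: "\<And>n. g n \<in> tree_aut T"
    and step: "\<And>n v. v \<in> verts T - subtree T (x n) \<Longrightarrow> g (Suc n) v = g n v"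
  obtains f where "f \<in> tree_aut T" "\<And>n v. v \<in> verts T - subtree T (x n) \<Longrightarrow> f v = g n v"
proof -
  have stable: "g m v = g n v" if "v \<in> verts T - subtree T (x n)" "n \<le> m" for m n v
    using that(2)
  proof (induction m rule: dec_induct)
    case (step k)
    then show ?case
      using assms(3)[of v k] that(1) subtree_ray_antimono[OF x, of n k] by auto
  qed simp
  define f where "f = (\<lambda>v\<in>verts T. g (Suc (lvl v)) v)"
  have outside: "v \<notin> subtree T (x n)" if "lvl v < n" for v n
    using subtree_lvl[of v "x n"] ray_lvl[OF x] that by auto
  have f: "f v = g n v" if "v \<in> verts T" "lvl v < n" for v n
    using stable[of v "Suc (lvl v)" n] outside[of v "Suc (lvl v)"] that unfolding f_def by simp
  have agree: "f v = g n v" if v: "v \<in> verts T - subtree T (x n)" for n v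
    using f[of v "max n (Suc (lvl v))"] stable[OF v, of "max n (Suc (lvl v))"] v by simp
  have common: "\<exists>n. f u = g n u \<and> f v = g n v" if "u \<in> verts T" "v \<in> verts T" for u v
    using f[OF that(1), of "Suc (max (lvl u) (lvl v))"] f[OF that(2), of "Suc (max (lvl u) (lvl v))"]
    by auto
  have "inj_on f (verts T)"
    using common tree_aut_inj[OF g] by (metis inj_onI)
  moreover have "f ` verts T = verts T"
  proof
    show "f ` verts T \<subseteq> verts T"
      using tree_aut_verts[OF g] unfolding f_def by auto
    show "verts T \<subseteq> f ` verts T"
    proof
      fix v
      assume v: "v \<in> verts T"
      let ?g = "g (Suc (lvl v))"
      \<comment> \<open>The preimage under \<open>?g\<close> has the same level as \<open>v\<close>,
        so the limit already agrees with \<open>?g\<close> at it.\<close>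
      define w where "w = (inv\<^bsub>Aut T\<^esub> ?g) v"
      have inv: "inv\<^bsub>Aut T\<^esub> ?g \<in> tree_aut T" using g by simp
      have w: "w \<in> verts T" "lvl w = lvl v"
        using tree_aut_verts[OF inv v] tree_aut_lvl[OF inv v] unfolding w_def by simp_all
      then have "f w = v"
        using f[OF w(1), of "Suc (lvl v)"] Aut_inv_apply(2)[OF g v] unfolding w_def by simp
      then show "v \<in> f ` verts T" using w(1) by blast
    qed
  qed
  moreover have "f \<in> extensional (verts T)" unfolding f_def by simp
  ultimately have "f \<in> Bij (verts T)" unfolding Bij_def bij_betw_def by blast
  moreover have "adj T (f u) (f v) \<longleftrightarrow> adj T u v" if "u \<in> verts T" "v \<in> verts T" for u v
    using common[OF that] tree_aut_adj[OF g that] by metis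
  moreover have "f (rootv T) = rootv T"
    using tree_aut_root[OF g] root_verts unfolding f_def by simp
  ultimately have "f \<in> tree_aut T" unfolding tree_aut_def by blast
  with agree that show thesis by blast
qed

section \<open>Conjugating pointwise stabilisers of subtrees\<close>

abbreviation conjugate :: "('v \<Rightarrow> 'v) \<Rightarrow> ('v \<Rightarrow> 'v) \<Rightarrow> 'v \<Rightarrow> 'v" where
  "conjugate a h \<equiv> a \<otimes>\<^bsub>Aut T\<^esub> h \<otimes>\<^bsub>Aut T\<^esub> inv\<^bsub>Aut T\<^esub> a"

lemma conj_apply:
  assumes "a \<in> tree_aut T" "h \<in> tree_aut T" "w \<in> verts T"
  shows "conjugate a h (a w) = a (h w)"
  using assms by (simp add: Aut_mult_apply Aut_inv_apply tree_aut_verts)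

lemma conj_fixes_subtree:
  assumes a: "a \<in> tree_aut T" and h: "h \<in> tree_aut T" and p: "p \<in> verts T"
    and fixed: "\<And>v. v \<in> subtree T p \<Longrightarrow> h v = v" and v: "v \<in> subtree T (a p)"
  shows "conjugate a h v = v"
proof -
  have verts: "v \<in> verts T" using subtree_verts[OF tree_aut_verts[OF a p] v] .
  define w where "w = (inv\<^bsub>Aut T\<^esub> a) v"
  have w: "a w = v" "w \<in> verts T"
    using Aut_inv_apply(2)[OF a verts] tree_aut_verts[OF _ verts] a unfolding w_def by simp_all
  then have "w \<in> subtree T p" using tree_aut_subtree_iff[OF a p w(2)] v by simp
  then show ?thesis using conj_apply[OF a h w(2)] fixed w(1) by simp
qed

text \<open>Below the common image of \<open>p\<close> both conjugates are trivial. Elsewhere only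
  values outside the subtree at \<open>p\<close> matter: \<open>h\<close> preserves that complement,
  and \<open>f\<close> and \<open>a\<close> agree on it.\<close>

lemma conj_eq_conj:
  assumes f: "f \<in> tree_aut T" and a: "a \<in> tree_aut T" and h: "h \<in> tree_aut T"
    and p: "p \<in> verts T" and fa: "f p = a p"
    and agree: "\<And>v. v \<in> verts T - subtree T p \<Longrightarrow> f v = a v"
    and fixed: "\<And>v. v \<in> subtree T p \<Longrightarrow> h v = v"
  shows "conjugate f h = conjugate a h"
proof (rule tree_aut_eqI)
  show "conjugate f h \<in> tree_aut T" "conjugate a h \<in> tree_aut T" using f a h by simp_all
  fix v
  assume v: "v \<in> verts T"
  define w where "w = (inv\<^bsub>Aut T\<^esub> f) v"
  have w: "f w = v" "w \<in> verts T"
    using Aut_inv_apply(2)[OF f v] tree_aut_verts[OF _ v] f unfolding w_def by simp_all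
  show "conjugate f h v = conjugate a h v"
  proof (cases "w \<in> subtree T p")
    case True
    then have "v \<in> subtree T (f p)" using tree_aut_subtree[OF f] w(1) by blast
    then show ?thesis
      using conj_fixes_subtree[OF f h p fixed] conj_fixes_subtree[OF a h p fixed] fa by simp
  next
    case False
    have hw: "h w \<in> verts T" using tree_aut_verts[OF h w(2)] .
    \<comment> \<open>Otherwise \<open>h\<close> would fix \<open>h w\<close>, and injectivity would
      put \<open>w\<close> into the subtree.\<close>
    have "h w \<notin> subtree T p"
    proof
      assume "h w \<in> subtree T p"
      then have "h w = w" using fixed tree_aut_inj[OF h hw w(2)] by blast
      with \<open>h w \<in> subtree T p\<close> False show False by simp
    qed
    then have "f (h w) = a (h w)" using agree hw by blast
    moreover have "a w = v" using agree False w by auto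
    ultimately show ?thesis
      using conj_apply[OF f h w(2)] conj_apply[OF a h w(2)] w(1) by simp
  qed
qed

lemma conj_in_subgroup: "subgroup G (Aut T) \<Longrightarrow> a \<in> G \<Longrightarrow> h \<in> G \<Longrightarrow> conjugate a h \<in> G"
  by (simp add: subgroup.m_closed subgroup.m_inv_closed)

text \<open>The limit \<open>f\<close> need not lie in \<open>G\<close>. On elements fixing the
  subtree at \<open>x n\<close> its conjugation equals that of \<open>g n\<close>, which does lie in
  \<open>G\<close>, so the conjugates stay in \<open>G\<close>.\<close>

lemma St0_conjugate:
  assumes branch: "branch_group T G" and x: "x \<in> boundary T" and y: "y \<in> boundary T"
    and children: "\<And>u. u \<in> verts T \<Longrightarrow> children T u \<noteq> {}"
  shows "\<exists>f \<in> tree_aut T. conjugate f ` St0 T G x = St0 T G y"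
proof -
  have G: "subgroup G (Aut T)" using branch unfolding branch_group_def by blast
  have sub: "G \<subseteq> tree_aut T" using subgroup.subset[OF G] carrier_Aut by simp
  note St0 = St0_iff[OF _ sub children]
  obtain g where g: "\<And>n. g n \<in> G" "\<And>n. g n (x n) = y n"
    "\<And>n v. v \<in> verts T - subtree T (x n) \<Longrightarrow> g (Suc n) v = g n v"
    using approximating_sequence[OF branch x y] by blast
  have aut: "g n \<in> tree_aut T" for n using g(1) sub by blast
  obtain f where f: "f \<in> tree_aut T"
    "\<And>n v. v \<in> verts T - subtree T (x n) \<Longrightarrow> f v = g n v"
    using limit_automorphism[of x g, OF x aut g(3)] by blast
  have fx: "f (x n) = g n (x n)" for n
  proof -
    \<comment> \<open>At \<open>x n\<close> itself the agreement of \<open>f\<close> with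
      \<open>g n\<close> is not given, so \<open>f\<close> is compared with
      \<open>g (Suc n)\<close>, which also sends \<open>x n\<close> to \<open>y n\<close>.\<close>
    have "x n \<notin> subtree T (x (Suc n))"
      using subtree_lvl[of "x n" "x (Suc n)"] ray_lvl[OF x] by auto
    then have "f (x n) = g (Suc n) (x n)" using f(2) ray_verts[OF x] by blast
    also have "\<dots> = y n"
      using rays_eq_above[OF tree_aut_ray[OF aut x] y, of "Suc n" "Suc n" n] g(2) by simp
    finally show ?thesis using g(2) by simp
  qed
  have conj_eq: "conjugate f h = conjugate (g n) h"
    if "h \<in> tree_aut T" "\<And>v. v \<in> subtree T (x n) \<Longrightarrow> h v = v" for h n
    using conj_eq_conj[OF f(1) aut that(1) ray_verts[OF x] fx f(2) that(2)] .
  have "conjugate f h \<in> St0 T G y" if h: "h \<in> St0 T G x" for h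
  proof -
    obtain n where hG: "h \<in> G" and n: "\<And>v. v \<in> subtree T (x n) \<Longrightarrow> h v = v"
      using h St0[OF x] by blast
    have haut: "h \<in> tree_aut T" using hG sub by blast
    have "conjugate (g n) h v = v" if "v \<in> subtree T (y n)" for v
      using conj_fixes_subtree[OF aut[of n] haut ray_verts[OF x, of n] n, of v] that g(2) by simp
    then show ?thesis
      using St0[OF y] conj_eq[OF haut n] conj_in_subgroup[OF G g(1) hG] by auto
  qed
  moreover have "t \<in> conjugate f ` St0 T G x" if t: "t \<in> St0 T G y" for t
  proof -
    obtain n where tG: "t \<in> G" and n: "\<And>v. v \<in> subtree T (y n) \<Longrightarrow> t v = v"
      using t St0[OF y] by blast
    have taut: "t \<in> tree_aut T" using tG sub by blast
    \<comment> \<open>The preimage is formed with \<open>g n\<close> instead of \<open>f\<close>, so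
      that it lies in \<open>G\<close>.\<close>
    define h where "h = conjugate (inv\<^bsub>Aut T\<^esub> g n) t"
    have inv: "inv\<^bsub>Aut T\<^esub> g n \<in> G" using subgroup.m_inv_closed[OF G g(1)] .
    have "(inv\<^bsub>Aut T\<^esub> g n) (y n) = x n"
      using Aut_inv_apply(1)[OF aut ray_verts[OF x]] g(2) by metis
    then have fixed: "h v = v" if "v \<in> subtree T (x n)" for v
      using conj_fixes_subtree[OF _ taut ray_verts[OF y, of n] n, of "inv\<^bsub>Aut T\<^esub> g n" v] that inv sub
      unfolding h_def by auto
    have hG: "h \<in> G" unfolding h_def by (rule conj_in_subgroup[OF G inv tG])
    have "g n \<otimes>\<^bsub>Aut T\<^esub> (inv\<^bsub>Aut T\<^esub> g n \<otimes>\<^bsub>Aut T\<^esub> t) = t"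
      using Aut.m_assoc[of "g n" "inv\<^bsub>Aut T\<^esub> g n" t] aut[of n] taut by simp
    then have "conjugate (g n) h = t"
      unfolding h_def using aut[of n] taut by (simp add: Aut.m_assoc)
    then have "conjugate f h = t" using conj_eq[OF _ fixed] hG sub by auto
    moreover have "h \<in> St0 T G x" using St0[OF x] hG fixed by blast
    ultimately show ?thesis by blast
  qed
  ultimately show ?thesis using f(1) by blast
qed

end

theorem corollary3p5:
  fixes T :: "'v rooted_graph" and G :: "('v \<Rightarrow> 'v) set"
  assumes "rooted_tree T" and "infinite (verts T)" and "locally_finite T"
    and "spherically_homogeneous T"
    and "branch_group T G"
  shows "\<forall>x \<in> boundary T. \<forall>y \<in> boundary T. \<exists>f \<in> carrier (Aut T).
    f <#\<^bsub>Aut T\<^esub> St0 T G x #>\<^bsub>Aut T\<^esub> inv\<^bsub>Aut T\<^esub> f = St0 T G y"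
proof (intro ballI)
  fix x y
  assume xy: "x \<in> boundary T" "y \<in> boundary T"
  interpret rtree T by unfold_locales (rule assms(1))
  \<comment> \<open>The lower bound on the number of children excludes leaves.\<close>
  have "children T u \<noteq> {}" if "u \<in> verts T" for u
    using assms(4) that unfolding spherically_homogeneous_def by fastforce
  then obtain f where f: "f \<in> tree_aut T" "conjugate f ` St0 T G x = St0 T G y"
    using St0_conjugate[OF assms(5) xy] by blast
  moreover have "f <#\<^bsub>Aut T\<^esub> S #>\<^bsub>Aut T\<^esub> inv\<^bsub>Aut T\<^esub> f = conjugate f ` S" for S
    unfolding l_coset_def r_coset_def by blast
  ultimately show "\<exists>f \<in> carrier (Aut T).
      f <#\<^bsub>Aut T\<^esub> St0 T G x #>\<^bsub>Aut T\<^esub> inv\<^bsub>Aut T\<^esub> f = St0 T G y"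
    using carrier_Aut by (auto intro: bexI[of _ f])
qed

end
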